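(* Every proximity searchable listing problem has a polynomial delay listing algorithm, i.e. an algorithm that, on each instance, outputs every solution in $\mathcal{S}$ exactly once with delay polynomial in $|\mathcal{U}|$.
   Context: A listing problem $\mathcal{P}$ has, for each instance, a finite universe $\mathcal{U}$ and a set of solutions $\mathcal{S}\subseteq 2^{\mathcal{U}}$ to be listed. $\mathcal{P}$ is proximity searchable if there exist a proximity function $\tilde{\cap}:\mathcal{S}\times\mathcal{S}\to 2^{\mathcal{U}}$ and a neighboring function $\mathrm{neighbors}:\mathcal{S}\to 2^{\mathcal{S}}$ such that: (1) one solution of $\mathcal{P}$ can be found in time polynomial in $|\mathcal{U}|$; (2) $\mathrm{neighbors}(\cdot)$ is computable in time polynomial in $|\mathcal{U}|$; (3) for any two distinct solutions $S,S^*\in\mathcal{S}$ there exists $S'\in\mathrm{neighbors}(S)$ with $|S'\,\tilde{\cap}\,S^*|>|S\,\tilde{\cap}\,S^*|$. The delay is the maximum time before the first output, between consecutive outputs, and after the last output until termination. *)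

theory Defs
  imports "HOL-Computational_Algebra.Polynomial"
begin

text \<open>
  The model of computation is a WHILE language over binary trees (S-expressions), in the style of
  Jones: a first-order pure LISP. Allocating a pair, following a pointer and testing for the
  atom are the only primitives, each at unit cost, so that a program can be run on a pointer
  machine or a RAM with constant overhead per step. Linked structures of exponential size can be
  built up and searched in time proportional to the length of the access path; this is what
  polynomial delay needs, and what Turing machines with sequential tapes do not offer.
\<close>

datatype sexp = Atom | Pair sexp sexp

fun hd_s :: "sexp \<Rightarrow> sexp" where
  "hd_s Atom = Atom"
| "hd_s (Pair a b) = a"

fun tl_s :: "sexp \<Rightarrow> sexp" where
  "tl_s Atom = Atom"
| "tl_s (Pair a b) = b"

fun nodes :: "sexp \<Rightarrow> nat" where
  "nodes Atom = 1"
| "nodes (Pair a b) = 1 + nodes a + nodes b"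

datatype expr = Var nat | AtomE | Cons expr expr | Hd expr | Tl expr

type_synonym state = "nat \<Rightarrow> sexp"

fun eval :: "expr \<Rightarrow> state \<Rightarrow> sexp" where
  "eval (Var x) s = s x"
| "eval AtomE s = Atom"
| "eval (Cons e f) s = Pair (eval e s) (eval f s)"
| "eval (Hd e) s = hd_s (eval e s)"
| "eval (Tl e) s = tl_s (eval e s)"

fun cost :: "expr \<Rightarrow> nat" where
  "cost (Var x) = 1"
| "cost AtomE = 1"
| "cost (Cons e f) = 1 + cost e + cost f"
| "cost (Hd e) = 1 + cost e"
| "cost (Tl e) = 1 + cost e"

datatype com =
    Skip
  | Assign nat expr
  | Seq com com
  | If expr com com
  | While expr com
  | Output expr

text \<open>
  A terminating execution is recorded as the sequence of its elementary time steps, interspersed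
  with the values it outputs. A guard is true iff it does not evaluate to the atom. Writing out a
  value takes time proportional to its number of nodes, with shared subtrees written out
  separately; without this charge a pointer to an arbitrarily large tree could be output in one
  step.
\<close>

datatype event = Tick | Out sexp

abbreviation ticks :: "nat \<Rightarrow> event list" where
  "ticks n \<equiv> replicate n Tick"

inductive exec :: "com \<Rightarrow> state \<Rightarrow> event list \<Rightarrow> state \<Rightarrow> bool" where
  Skip: "exec Skip s (ticks 1) s"
| Assign: "exec (Assign x e) s (ticks (1 + cost e)) (s(x := eval e s))"
| Seq: "exec c s tr s' \<Longrightarrow> exec d s' tr' s'' \<Longrightarrow> exec (Seq c d) s (tr @ tr') s''"
| IfTrue: "eval b s \<noteq> Atom \<Longrightarrow> exec c s tr s' \<Longrightarrow>
    exec (If b c d) s (ticks (1 + cost b) @ tr) s'"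
| IfFalse: "eval b s = Atom \<Longrightarrow> exec d s tr s' \<Longrightarrow>
    exec (If b c d) s (ticks (1 + cost b) @ tr) s'"
| WhileFalse: "eval b s = Atom \<Longrightarrow> exec (While b c) s (ticks (1 + cost b)) s"
| WhileTrue: "eval b s \<noteq> Atom \<Longrightarrow> exec c s tr s' \<Longrightarrow> exec (While b c) s' tr' s'' \<Longrightarrow>
    exec (While b c) s (ticks (1 + cost b) @ tr @ tr') s''"
| Output: "exec (Output e) s (ticks (cost e + nodes (eval e s)) @ [Out (eval e s)]) s"

lemma exec_deterministic:
  "exec c s tr s' \<Longrightarrow> exec c s tr' s'' \<Longrightarrow> tr' = tr \<and> s'' = s'"
proof (induction arbitrary: tr' s'' rule: exec.induct)
  case (Seq c s tr s' d tr2 s2)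
  from Seq.prems show ?case by cases (use Seq.IH in blast)
next
  case (IfTrue b s c tr s' d)
  from IfTrue.prems show ?case by cases (use IfTrue in blast)+
next
  case (IfFalse b s d tr s' c)
  from IfFalse.prems show ?case by cases (use IfFalse in blast)+
next
  case (WhileTrue b s c tr s' tr2 s2)
  from WhileTrue.prems show ?case by cases (use WhileTrue in blast)+
qed (auto elim: exec.cases)

text \<open>The input is placed in variable 0; all other variables are initially the atom.\<close>

definition runs :: "com \<Rightarrow> sexp \<Rightarrow> event list \<Rightarrow> bool" where
  "runs c v tr \<longleftrightarrow> (\<exists>s. exec c ((\<lambda>_. Atom)(0 := v)) tr s)"

fun outputs :: "event list \<Rightarrow> sexp list" where
  "outputs [] = []"
| "outputs (Tick # tr) = outputs tr"
| "outputs (Out v # tr) = v # outputs tr"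

definition time :: "event list \<Rightarrow> nat" where
  "time tr = length (filter (\<lambda>ev. ev = Tick) tr)"

text \<open>
  \<open>gaps 0 tr\<close> lists the times elapsed before the first output, between consecutive outputs, and
  after the last output until termination; the first argument is the time elapsed since the
  previous output.
\<close>

fun gaps :: "nat \<Rightarrow> event list \<Rightarrow> nat list" where
  "gaps k [] = [k]"
| "gaps k (Tick # tr) = gaps (Suc k) tr"
| "gaps k (Out v # tr) = k # gaps 0 tr"

definition delay :: "event list \<Rightarrow> nat" where
  "delay tr = Max (set (gaps 0 tr))"


text \<open>
  \<open>input\<close> is the machine representation of an instance and \<open>elements\<close> an enumeration of its
  universe, by means of which subsets of the universe are represented as characteristic vectors.
\<close>

record ('i, 'u) listing_problem =
  instances :: "'i set"
  input :: "'i \<Rightarrow> sexp"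
  elements :: "'i \<Rightarrow> 'u list"
  solutions :: "'i \<Rightarrow> 'u set set"

definition universe :: "('i, 'u) listing_problem \<Rightarrow> 'i \<Rightarrow> 'u set" where
  "universe P i = set (elements P i)"

definition listing_problem :: "('i, 'u) listing_problem \<Rightarrow> bool" where
  "listing_problem P \<longleftrightarrow>
    (\<forall>i\<in>instances P. distinct (elements P i) \<and> solutions P i \<subseteq> Pow (universe P i))"

definition encode_bool :: "bool \<Rightarrow> sexp" where
  "encode_bool b = (if b then Pair Atom Atom else Atom)"

definition encode_list :: "sexp list \<Rightarrow> sexp" where
  "encode_list vs = foldr Pair vs Atom"

definition encode_set :: "('i, 'u) listing_problem \<Rightarrow> 'i \<Rightarrow> 'u set \<Rightarrow> sexp" where
  "encode_set P i S = encode_list (map (\<lambda>u. encode_bool (u \<in> S)) (elements P i))"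

lemma encode_list_inject: "encode_list vs = encode_list ws \<longleftrightarrow> vs = ws"
proof (induction vs arbitrary: ws)
  case Nil
  show ?case by (cases ws) (auto simp: encode_list_def)
next
  case (Cons v vs)
  then show ?case by (cases ws) (auto simp: encode_list_def)
qed

lemma inj_on_encode_set: "inj_on (encode_set P i) (Pow (universe P i))"
  by (auto simp: inj_on_def encode_set_def encode_list_inject universe_def encode_bool_def
      split: if_splits)

text \<open>
  As a search problem: a program outputs one solution, or nothing if the instance has no solution.
\<close>

definition solution_poly_time :: "('i, 'u) listing_problem \<Rightarrow> bool" where
  "solution_poly_time P \<longleftrightarrow>
    (\<exists>c (p :: nat poly). \<forall>i\<in>instances P. \<exists>tr.
      runs c (input P i) tr \<and>
      time tr \<le> poly p (card (universe P i)) \<and>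
      (if solutions P i = {} then outputs tr = []
       else \<exists>S\<in>solutions P i. outputs tr = [encode_set P i S]))"

text \<open>
  A set of solutions is computed by outputting its members one by one, in any order and possibly
  with repetitions.
\<close>

definition neighbors_poly_time ::
    "('i, 'u) listing_problem \<Rightarrow> ('i \<Rightarrow> 'u set \<Rightarrow> 'u set set) \<Rightarrow> bool" where
  "neighbors_poly_time P neighbors \<longleftrightarrow>
    (\<exists>c (p :: nat poly). \<forall>i\<in>instances P. \<forall>S\<in>solutions P i. \<exists>tr.
      runs c (Pair (input P i) (encode_set P i S)) tr \<and>
      time tr \<le> poly p (card (universe P i)) \<and>
      set (outputs tr) = encode_set P i ` neighbors i S)"

definition proximity_searchable :: "('i, 'u) listing_problem \<Rightarrow> bool" where
  "proximity_searchable P \<longleftrightarrow>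
    (\<exists>(prox :: 'i \<Rightarrow> 'u set \<Rightarrow> 'u set \<Rightarrow> 'u set) (neighbors :: 'i \<Rightarrow> 'u set \<Rightarrow> 'u set set).
      (\<forall>i\<in>instances P. \<forall>S\<in>solutions P i. \<forall>T\<in>solutions P i. prox i S T \<subseteq> universe P i) \<and>
      (\<forall>i\<in>instances P. \<forall>S\<in>solutions P i. neighbors i S \<subseteq> solutions P i) \<and>
      solution_poly_time P \<and>
      neighbors_poly_time P neighbors \<and>
      (\<forall>i\<in>instances P. \<forall>S\<in>solutions P i. \<forall>T\<in>solutions P i. S \<noteq> T \<longrightarrow>
        (\<exists>S'\<in>neighbors i S. card (prox i S' T) > card (prox i S T))))"

definition poly_delay_listing_algorithm :: "('i, 'u) listing_problem \<Rightarrow> com \<Rightarrow> bool" where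
  "poly_delay_listing_algorithm P c \<longleftrightarrow>
    (\<exists>p :: nat poly. \<forall>i\<in>instances P. \<exists>tr.
      runs c (input P i) tr \<and>
      distinct (outputs tr) \<and>
      set (outputs tr) = encode_set P i ` solutions P i \<and>
      delay tr \<le> poly p (card (universe P i)))"

end

theory Submission
  imports Defs
begin

text \<open>
  Search the graph of the neighboring function from one solution, with a worklist and a set of
  solutions already seen, and output each solution when it leaves the worklist: the time between
  two outputs is then that of one call of the neighboring function plus one lookup per neighbor.
  Every solution \<open>T\<close> is reached, since a reached solution of maximal proximity to \<open>T\<close> must be \<open>T\<close>.
  The set of seen solutions may be exponentially large; it is stored as a binary trie along the
  characteristic vectors, so that a lookup or insertion takes time linear in the size of the
  universe. Trees being immutable, insertion rebuilds the access path from a stack of siblings.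
\<close>

section \<open>Silent computations\<close>

text \<open>Only an upper bound on the time is kept, so that bounds can be added up along a program
  and weakened at will. A trace of ticks alone means that nothing is output.\<close>

definition computes :: "com \<Rightarrow> state \<Rightarrow> nat \<Rightarrow> state \<Rightarrow> bool" where
  "computes c s k s' \<longleftrightarrow> (\<exists>t\<le>k. exec c s (ticks t) s')"

lemma computes_mono: "computes c s k s' \<Longrightarrow> k \<le> l \<Longrightarrow> computes c s l s'"
  unfolding computes_def by (meson order_trans)

lemma computes_Skip: "computes Skip s 1 s"
  unfolding computes_def using exec.Skip by blast

lemma computes_Assign: "computes (Assign x e) s (1 + cost e) (s(x := eval e s))"
  unfolding computes_def using exec.Assign by blast

lemma computes_Seq:
  assumes "computes c s k s'" "computes d s' l s''"
  shows "computes (Seq c d) s (k + l) s''"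
proof -
  obtain t u where "t \<le> k" "exec c s (ticks t) s'" "u \<le> l" "exec d s' (ticks u) s''"
    using assms unfolding computes_def by blast
  then have "t + u \<le> k + l" "exec (Seq c d) s (ticks (t + u)) s''"
    using exec.Seq by (auto simp: replicate_add)
  then show ?thesis unfolding computes_def by blast
qed

lemma computes_If:
  assumes "computes (if eval b s \<noteq> Atom then c else d) s k s'"
  shows "computes (If b c d) s (1 + cost b + k) s'"
proof -
  obtain t where t: "t \<le> k" "exec (if eval b s \<noteq> Atom then c else d) s (ticks t) s'"
    using assms unfolding computes_def by blast
  have "exec (If b c d) s (ticks (1 + cost b) @ ticks t) s'"
    using t(2) exec.IfTrue exec.IfFalse by (cases "eval b s = Atom") (simp_all del: replicate_Suc)
  then have "exec (If b c d) s (ticks (1 + cost b + t)) s'"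
    by (simp only: replicate_add)
  then show ?thesis
    unfolding computes_def using t(1) by (meson add_left_mono)
qed

lemma computes_WhileFalse:
  "eval b s = Atom \<Longrightarrow> computes (While b c) s (1 + cost b) s"
  unfolding computes_def using exec.WhileFalse by blast

lemma computes_WhileTrue:
  assumes "eval b s \<noteq> Atom" "computes c s k s'" "computes (While b c) s' l s''"
  shows "computes (While b c) s (1 + cost b + k + l) s''"
proof -
  obtain t u where t: "t \<le> k" "exec c s (ticks t) s'" "u \<le> l" "exec (While b c) s' (ticks u) s''"
    using assms unfolding computes_def by blast
  have "exec (While b c) s (ticks (1 + cost b + t + u)) s''"
    using exec.WhileTrue[OF assms(1) t(2,4)] by (simp only: replicate_add append_assoc)
  moreover have "1 + cost b + t + u \<le> 1 + cost b + k + l" using t by simp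
  ultimately show ?thesis unfolding computes_def by blast
qed

section \<open>Straight-line programs\<close>

fun straight :: "com \<Rightarrow> bool" where
  "straight (Seq c d) = (straight c \<and> straight d)"
| "straight (If e c d) = (straight c \<and> straight d)"
| "straight (While e c) = False"
| "straight (Output e) = False"
| "straight _ = True"

text \<open>The last equation is meant for \<open>Skip\<close>; on \<open>While\<close> and
  \<open>Output\<close> it gives a dummy value, and \<open>straight\<close> excludes these
  commands.\<close>

fun effect :: "com \<Rightarrow> state \<Rightarrow> state" where
  "effect (Assign x e) s = s(x := eval e s)"
| "effect (Seq c d) s = effect d (effect c s)"
| "effect (If e c d) s = (if eval e s \<noteq> Atom then effect c s else effect d s)"
| "effect _ s = s"

fun steps :: "com \<Rightarrow> nat" where
  "steps (Assign x e) = 1 + cost e"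
| "steps (Seq c d) = steps c + steps d"
| "steps (If e c d) = 1 + cost e + max (steps c) (steps d)"
| "steps _ = 1"

text \<open>For code without loops and outputs, final state and time bound are found by rewriting; a
  conditional is charged for its costlier branch. This handles the fixed blocks of the search
  without derivations in \<open>exec\<close>.\<close>

lemma computes_straight: "straight c \<Longrightarrow> computes c s (steps c) (effect c s)"
proof (induction c arbitrary: s)
  case (If e c d)
  then have "computes c s (steps c) (effect c s)" "computes d s (steps d) (effect d s)"
    by auto
  then have "computes (if eval e s \<noteq> Atom then c else d) s (max (steps c) (steps d))
      (effect (If e c d) s)"
    by (auto intro: computes_mono)
  then show ?case using computes_If by simp
qed (auto intro: computes_Skip[simplified] computes_Assign[simplified] computes_Seq)

section \<open>Time, outputs and gaps of a trace\<close>

lemma time_append [simp]: "time (tr @ tr') = time tr + time tr'"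
  by (simp add: time_def)

lemma time_ticks [simp]: "time (ticks n) = n"
  by (simp add: time_def)

lemma outputs_append [simp]: "outputs (tr @ tr') = outputs tr @ outputs tr'"
  by (induction tr rule: outputs.induct) auto

lemma outputs_ticks [simp]: "outputs (ticks n) = []"
  by (induction n) auto

lemma gaps_ticks_append [simp]: "gaps k (ticks n @ tr) = gaps (k + n) tr"
  by (induction n arbitrary: k) auto

lemma gaps_ticks [simp]: "gaps k (ticks n) = [k + n]"
  using gaps_ticks_append[of k n "[]"] by simp

lemma cost_pos: "0 < cost e"
  by (cases e) auto

text \<open>Writing a value takes at least one tick. The running time of the neighboring program
  therefore also bounds the number of neighbors it lists, repetitions included.\<close>

lemma length_outputs_le_time: "exec c s tr s' \<Longrightarrow> length (outputs tr) \<le> time tr"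
proof (induction rule: exec.induct)
  case (Output e s)
  then show ?case using cost_pos[of e] by (simp add: time_def)
qed (simp_all del: replicate_Suc)

section \<open>Running a program as a subroutine\<close>

text \<open>
  Variables 0 to 7 belong to the search; variable \<open>x\<close> of a subroutine becomes \<open>8 + x\<close>.
\<close>

abbreviation (input) "trie_var \<equiv> 2 :: nat"
abbreviation (input) "todo_var \<equiv> 3 :: nat"
abbreviation (input) "found_var \<equiv> 4 :: nat"
abbreviation (input) "key_var \<equiv> 5 :: nat"
abbreviation (input) "sub_var \<equiv> 6 :: nat"
abbreviation (input) "path_var \<equiv> 7 :: nat"

text \<open>A strict upper bound on the variable indices: a program works on finitely many
  variables, known in advance.\<close>

fun expr_bound :: "expr \<Rightarrow> nat" where
  "expr_bound (Var x) = Suc x"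
| "expr_bound AtomE = 0"
| "expr_bound (Cons e f) = max (expr_bound e) (expr_bound f)"
| "expr_bound (Hd e) = expr_bound e"
| "expr_bound (Tl e) = expr_bound e"

fun com_bound :: "com \<Rightarrow> nat" where
  "com_bound Skip = 0"
| "com_bound (Assign x e) = max (Suc x) (expr_bound e)"
| "com_bound (Seq c d) = max (com_bound c) (com_bound d)"
| "com_bound (If e c d) = max (expr_bound e) (max (com_bound c) (com_bound d))"
| "com_bound (While e c) = max (expr_bound e) (com_bound c)"
| "com_bound (Output e) = expr_bound e"

fun shift :: "expr \<Rightarrow> expr" where
  "shift (Var x) = Var (8 + x)"
| "shift AtomE = AtomE"
| "shift (Cons e f) = Cons (shift e) (shift f)"
| "shift (Hd e) = Hd (shift e)"
| "shift (Tl e) = Tl (shift e)"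

text \<open>The outputs of a subroutine must not appear in the trace of the search, so they are
  pushed on a list instead, the latest on top.\<close>

fun collect :: "com \<Rightarrow> com" where
  "collect Skip = Skip"
| "collect (Assign x e) = Assign (8 + x) (shift e)"
| "collect (Seq c d) = Seq (collect c) (collect d)"
| "collect (If e c d) = If (shift e) (collect c) (collect d)"
| "collect (While e c) = While (shift e) (collect c)"
| "collect (Output e) = Assign found_var (Cons (shift e) (Var found_var))"

lemma cost_shift [simp]: "cost (shift e) = cost e"
  by (induction e) auto

lemma eval_shift:
  "expr_bound e \<le> N \<Longrightarrow> \<forall>x<N. \<sigma> (8 + x) = s x \<Longrightarrow> eval (shift e) \<sigma> = eval e s"
  by (induction e) auto

text \<open>The renamed program mirrors every step at the same cost, except for outputs: writing
  costs at least \<open>cost e + 1\<close>, pushing costs \<open>cost e + 3\<close>, hence the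
  factor 3. Agreement is demanded only below \<open>N\<close>, since variables out of reach of the
  program may hold anything. Pushing reverses the order of the outputs.\<close>

lemma computes_collect:
  assumes "exec c s tr s'" "com_bound c \<le> N" "\<forall>x<N. \<sigma> (8 + x) = s x"
  shows "\<exists>\<sigma>'. computes (collect c) \<sigma> (3 * time tr) \<sigma>' \<and> (\<forall>x<N. \<sigma>' (8 + x) = s' x) \<and>
    (\<forall>y<8. y \<noteq> found_var \<longrightarrow> \<sigma>' y = \<sigma> y) \<and>
    \<sigma>' found_var = foldr Pair (rev (outputs tr)) (\<sigma> found_var)"
  using assms
proof (induction arbitrary: \<sigma> rule: exec.induct)
  case (Skip s)
  then show ?case
    using computes_mono[OF computes_Skip, of 3 \<sigma>]
    by (intro exI[of _ \<sigma>]) (simp add: time_def)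
next
  case (Assign x e s)
  have e: "eval (shift e) \<sigma> = eval e s"
    using Assign eval_shift[of e N] by auto
  have run: "computes (collect (Assign x e)) \<sigma> (3 * (1 + cost e)) (\<sigma>(8 + x := eval e s))"
    unfolding collect.simps e[symmetric]
    by (rule computes_mono[OF computes_Assign]) simp
  show ?case
    by (intro exI[of _ "\<sigma>(8 + x := eval e s)"] conjI, simp only: time_ticks run)
      (use Assign in \<open>simp_all del: replicate_Suc\<close>)
next
  case (Seq c s tr s' d tr' s'')
  obtain \<sigma>1 where 1: "computes (collect c) \<sigma> (3 * time tr) \<sigma>1" "\<forall>x<N. \<sigma>1 (8 + x) = s' x"
    "\<forall>y<8. y \<noteq> found_var \<longrightarrow> \<sigma>1 y = \<sigma> y"
    "\<sigma>1 found_var = foldr Pair (rev (outputs tr)) (\<sigma> found_var)"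
    using Seq.IH(1)[of \<sigma>] Seq.prems by auto
  obtain \<sigma>2 where 2: "computes (collect d) \<sigma>1 (3 * time tr') \<sigma>2" "\<forall>x<N. \<sigma>2 (8 + x) = s'' x"
    "\<forall>y<8. y \<noteq> found_var \<longrightarrow> \<sigma>2 y = \<sigma>1 y"
    "\<sigma>2 found_var = foldr Pair (rev (outputs tr')) (\<sigma>1 found_var)"
    using Seq.IH(2)[of \<sigma>1] Seq.prems 1 by auto
  show ?case
    using computes_Seq[OF 1(1) 2(1)] 1 2 by (intro exI[of _ \<sigma>2]) (simp add: algebra_simps)
next
  case (IfTrue b s c tr s' d)
  obtain \<sigma>1 where 1: "computes (collect c) \<sigma> (3 * time tr) \<sigma>1" "\<forall>x<N. \<sigma>1 (8 + x) = s' x"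
    "\<forall>y<8. y \<noteq> found_var \<longrightarrow> \<sigma>1 y = \<sigma> y"
    "\<sigma>1 found_var = foldr Pair (rev (outputs tr)) (\<sigma> found_var)"
    using IfTrue.IH[of \<sigma>] IfTrue.prems by auto
  have "eval (shift b) \<sigma> = eval b s"
    using IfTrue.prems eval_shift[of b N] by auto
  then have "computes (collect (If b c d)) \<sigma> (1 + cost b + 3 * time tr) \<sigma>1"
    using computes_If[of "shift b" \<sigma> "collect c" "collect d" "3 * time tr" \<sigma>1] 1(1) IfTrue.hyps
    by simp
  then have "computes (collect (If b c d)) \<sigma> (3 * (1 + cost b + time tr)) \<sigma>1"
    by (rule computes_mono) simp
  then show ?case
    using 1 by (intro exI[of _ \<sigma>1]) (simp del: replicate_Suc)
next
  case (IfFalse b s d tr s' c)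
  obtain \<sigma>1 where 1: "computes (collect d) \<sigma> (3 * time tr) \<sigma>1" "\<forall>x<N. \<sigma>1 (8 + x) = s' x"
    "\<forall>y<8. y \<noteq> found_var \<longrightarrow> \<sigma>1 y = \<sigma> y"
    "\<sigma>1 found_var = foldr Pair (rev (outputs tr)) (\<sigma> found_var)"
    using IfFalse.IH[of \<sigma>] IfFalse.prems by auto
  have "eval (shift b) \<sigma> = eval b s"
    using IfFalse.prems eval_shift[of b N] by auto
  then have "computes (collect (If b c d)) \<sigma> (1 + cost b + 3 * time tr) \<sigma>1"
    using computes_If[of "shift b" \<sigma> "collect c" "collect d" "3 * time tr" \<sigma>1] 1(1) IfFalse.hyps
    by simp
  then have "computes (collect (If b c d)) \<sigma> (3 * (1 + cost b + time tr)) \<sigma>1"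
    by (rule computes_mono) simp
  then show ?case
    using 1 by (intro exI[of _ \<sigma>1]) (simp del: replicate_Suc)
next
  case (WhileFalse b s c)
  have "eval (shift b) \<sigma> = eval b s"
    using WhileFalse.prems eval_shift[of b N] by auto
  then have "computes (collect (While b c)) \<sigma> (1 + cost b) \<sigma>"
    using computes_WhileFalse[of "shift b" \<sigma> "collect c"] WhileFalse.hyps by simp
  then have "computes (collect (While b c)) \<sigma> (3 * (1 + cost b)) \<sigma>"
    by (rule computes_mono) simp
  then show ?case
    using WhileFalse.prems by (intro exI[of _ \<sigma>]) (simp del: replicate_Suc)
next
  case (WhileTrue b s c tr s' tr' s'')
  obtain \<sigma>1 where 1: "computes (collect c) \<sigma> (3 * time tr) \<sigma>1" "\<forall>x<N. \<sigma>1 (8 + x) = s' x"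
    "\<forall>y<8. y \<noteq> found_var \<longrightarrow> \<sigma>1 y = \<sigma> y"
    "\<sigma>1 found_var = foldr Pair (rev (outputs tr)) (\<sigma> found_var)"
    using WhileTrue.IH(1)[of \<sigma>] WhileTrue.prems by auto
  obtain \<sigma>2 where 2: "computes (collect (While b c)) \<sigma>1 (3 * time tr') \<sigma>2"
    "\<forall>x<N. \<sigma>2 (8 + x) = s'' x"
    "\<forall>y<8. y \<noteq> found_var \<longrightarrow> \<sigma>2 y = \<sigma>1 y"
    "\<sigma>2 found_var = foldr Pair (rev (outputs tr')) (\<sigma>1 found_var)"
    using WhileTrue.IH(2)[of \<sigma>1] WhileTrue.prems 1 by auto
  have "eval (shift b) \<sigma> = eval b s"
    using WhileTrue.prems eval_shift[of b N] by auto
  then have "computes (collect (While b c)) \<sigma> (1 + cost b + 3 * time tr + 3 * time tr') \<sigma>2"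
    using computes_WhileTrue[of "shift b" \<sigma> "collect c"] 1(1) 2(1) WhileTrue.hyps by simp
  then have "computes (collect (While b c)) \<sigma> (3 * (1 + cost b + (time tr + time tr'))) \<sigma>2"
    by (rule computes_mono) simp
  then show ?case
    using 1 2 by (intro exI[of _ \<sigma>2]) (simp del: replicate_Suc)
next
  case (Output e s)
  have "eval (shift e) \<sigma> = eval e s"
    using Output eval_shift[of e N] by auto
  then have e: "eval (Cons (shift e) (Var found_var)) \<sigma> = Pair (eval e s) (\<sigma> found_var)"
    by simp
  have run: "computes (collect (Output e)) \<sigma> (3 * (cost e + nodes (eval e s)))
      (\<sigma>(found_var := Pair (eval e s) (\<sigma> found_var)))"
    unfolding collect.simps e[symmetric]
    by (rule computes_mono[OF computes_Assign], cases "eval e s") (use cost_pos[of e] in auto)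
  moreover have "time (ticks (cost e + nodes (eval e s)) @ [Out (eval e s)]) =
      cost e + nodes (eval e s)"
    by (simp add: time_def)
  ultimately show ?case
    by (intro exI[of _ "\<sigma>(found_var := Pair (eval e s) (\<sigma> found_var))"] conjI, simp only:)
      (use Output in simp_all)
qed

text \<open>The behavior of a program is specified only for runs in which all variables but the
  input start as the atom; an earlier call may have left other values. The number of variables to
  reset depends on the program alone, so this takes constant time per call.\<close>

fun clear :: "nat \<Rightarrow> com" where
  "clear 0 = Skip"
| "clear (Suc n) = Seq (clear n) (Assign (8 + n) AtomE)"

lemma computes_clear:
  "computes (clear n) s (1 + 2 * n) (\<lambda>y. if 8 \<le> y \<and> y < 8 + n then Atom else s y)"
proof (induction n)
  case 0
  have "(\<lambda>y. if 8 \<le> y \<and> y < 8 + 0 then Atom else s y) = s"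
    by (rule ext) auto
  then show ?case using computes_Skip[of s] by (simp only: clear.simps mult_0_right add_0_right)
next
  case (Suc n)
  have "(\<lambda>y. if 8 \<le> y \<and> y < 8 + Suc n then Atom else s y) =
    (\<lambda>y. if 8 \<le> y \<and> y < 8 + n then Atom else s y)(8 + n := Atom)"
    by auto
  moreover have "computes (clear (Suc n)) s (1 + 2 * Suc n)
      ((\<lambda>y. if 8 \<le> y \<and> y < 8 + n then Atom else s y)(8 + n := eval AtomE s))"
    unfolding clear.simps eval.simps
    by (rule computes_mono[OF computes_Seq[OF Suc
        computes_Assign[of _ AtomE, simplified eval.simps]]]) simp
  ultimately show ?case by (simp only: eval.simps)
qed

text \<open>Variable 8 is the image of the input variable 0. The argument is evaluated after the
  cleanup, so it may refer only to variables of the search.\<close>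

definition subroutine :: "com \<Rightarrow> expr \<Rightarrow> com" where
  "subroutine c e = Seq (Seq (clear (com_bound c)) (Assign 8 e)) (collect c)"

text \<open>Apart from an overhead fixed by \<open>c\<close> and \<open>e\<close>, a call is linear
  in the time of the original run, and of the search variables only \<open>found_var\<close>
  changes.\<close>

lemma computes_subroutine:
  assumes "runs c v tr" "expr_bound e \<le> 8" "eval e \<sigma> = v"
  shows "\<exists>\<sigma>'. computes (subroutine c e) \<sigma> (2 + 2 * com_bound c + cost e + 3 * time tr) \<sigma>' \<and>
    (\<forall>y<8. y \<noteq> found_var \<longrightarrow> \<sigma>' y = \<sigma> y) \<and>
    \<sigma>' found_var = foldr Pair (rev (outputs tr)) (\<sigma> found_var)"
proof -
  let ?\<sigma>1 = "\<lambda>y. if 8 \<le> y \<and> y < 8 + com_bound c then Atom else \<sigma> y"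
  obtain s where s: "exec c ((\<lambda>_. Atom)(0 := v)) tr s"
    using assms(1) unfolding runs_def by blast
  have eval_e: "eval e ?\<sigma>1 = eval e \<sigma>"
    using assms(2) by (induction e) simp_all
  have 1: "computes (Seq (clear (com_bound c)) (Assign 8 e)) \<sigma>
      (1 + 2 * com_bound c + (1 + cost e)) (?\<sigma>1(8 := v))"
    using computes_Seq[OF computes_clear computes_Assign[of 8 e], of "com_bound c" \<sigma>]
    unfolding eval_e assms(3) .
  have "\<forall>x<com_bound c. (?\<sigma>1(8 := v)) (8 + x) = ((\<lambda>_. Atom)(0 := v)) x"
    by auto
  from computes_collect[OF s order_refl this] obtain \<sigma>' where 2:
    "computes (collect c) (?\<sigma>1(8 := v)) (3 * time tr) \<sigma>'"
    "\<forall>y<8. y \<noteq> found_var \<longrightarrow> \<sigma>' y = (?\<sigma>1(8 := v)) y"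
    "\<sigma>' found_var = foldr Pair (rev (outputs tr)) ((?\<sigma>1(8 := v)) found_var)"
    by blast
  have "computes (subroutine c e) \<sigma> (2 + 2 * com_bound c + cost e + 3 * time tr) \<sigma>'"
    unfolding subroutine_def by (rule computes_mono[OF computes_Seq[OF 1 2(1)]]) simp
  then show ?thesis
    using 2(2,3) by (intro exI[of _ \<sigma>']) simp
qed

section \<open>Tries\<close>

definition encode_key :: "bool list \<Rightarrow> sexp" where
  "encode_key bs = encode_list (map encode_bool bs)"

lemma encode_key_simps [simp]:
  "encode_key [] = Atom"
  "encode_key (b # bs) = Pair (encode_bool b) (encode_key bs)"
  by (simp_all add: encode_key_def encode_list_def)

lemma encode_bool_simps [simp]: "encode_bool True = Pair Atom Atom" "encode_bool False = Atom"
  by (simp_all add: encode_bool_def)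

text \<open>Each entry adds one node for the spine and at most three for the bit. This bounds the
  time for writing out a solution.\<close>

lemma nodes_encode_key: "nodes (encode_key bs) \<le> 1 + 4 * length bs"
  by (induction bs) (auto simp: encode_bool_def)

lemma inj_encode_key: "inj encode_key"
proof -
  have "inj encode_bool" by (auto simp: inj_def encode_bool_def split: if_splits)
  then show ?thesis
    unfolding encode_key_def by (auto simp: inj_def encode_list_inject inj_map_eq_map)
qed

text \<open>Since \<open>hd_s\<close> and \<open>tl_s\<close> map the atom to itself, the atom
  serves as the empty trie at every depth and the way down needs no emptiness test.\<close>

definition child :: "bool \<Rightarrow> sexp \<Rightarrow> sexp" where
  "child b t = (if b then tl_s t else hd_s t)"

fun subtrie :: "sexp \<Rightarrow> bool list \<Rightarrow> sexp" where
  "subtrie t [] = t"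
| "subtrie t (b # bs) = subtrie (child b t) bs"

definition join :: "bool \<Rightarrow> sexp \<Rightarrow> sexp \<Rightarrow> sexp" where
  "join b sibling t = (if b then Pair sibling t else Pair t sibling)"

fun insert_key :: "sexp \<Rightarrow> bool list \<Rightarrow> sexp" where
  "insert_key t [] = Pair Atom Atom"
| "insert_key t (b # bs) = join b (child (\<not> b) t) (insert_key (child b t) bs)"

text \<open>Insertion turns every node on its path into a pair, so prefixes of an inserted key look
  present as well. Among keys of equal length, no path ends in the interior of another one.\<close>

lemma subtrie_insert_key:
  "length bs = length cs \<Longrightarrow>
    subtrie (insert_key t bs) cs \<noteq> Atom \<longleftrightarrow> bs = cs \<or> subtrie t cs \<noteq> Atom"
proof (induction bs arbitrary: cs t)
  case (Cons b bs)
  then obtain c ds where "cs = c # ds" "length bs = length ds" by (cases cs) auto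
  then show ?case using Cons.IH[of ds] by (auto simp: join_def child_def)
qed auto

lemma subtrie_Atom [simp]: "subtrie Atom bs = Atom"
  by (induction bs) (auto simp: child_def)

definition trie_of :: "nat \<Rightarrow> bool list set \<Rightarrow> sexp \<Rightarrow> bool" where
  "trie_of n V t \<longleftrightarrow> (\<forall>bs. length bs = n \<longrightarrow> (subtrie t bs \<noteq> Atom \<longleftrightarrow> bs \<in> V))"

lemma trie_of_empty: "trie_of n {} Atom"
  by (simp add: trie_of_def)

lemma trie_of_insert:
  "trie_of n V t \<Longrightarrow> length bs = n \<Longrightarrow> trie_of n (insert bs V) (insert_key t bs)"
  by (auto simp: trie_of_def subtrie_insert_key)

section \<open>Access paths as stacks of siblings\<close>

type_synonym frames = "(bool \<times> sexp) list"

definition encode_frames :: "frames \<Rightarrow> sexp" where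
  "encode_frames fs = encode_list (map (\<lambda>(b, t). Pair (encode_bool b) t) fs)"

lemma encode_frames_simps [simp]:
  "encode_frames [] = Atom"
  "encode_frames ((b, t) # fs) = Pair (Pair (encode_bool b) t) (encode_frames fs)"
  by (simp_all add: encode_frames_def encode_list_def)

text \<open>This is the zipper of the trie: a frame keeps the direction taken and the sibling left
  behind, the deepest frame first.\<close>

fun descend :: "sexp \<Rightarrow> bool list \<Rightarrow> frames \<Rightarrow> frames" where
  "descend t [] fs = fs"
| "descend t (b # bs) fs = descend (child b t) bs ((b, child (\<not> b) t) # fs)"

fun plug :: "sexp \<Rightarrow> frames \<Rightarrow> sexp" where
  "plug t [] = t"
| "plug t ((b, sibling) # fs) = plug (join b sibling t) fs"

text \<open>The language has no recursion, so \<open>insert_key\<close> is split into a loop going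
  down and a loop going up. The stack \<open>fs\<close> is arbitrary because each step down adds a
  frame.\<close>

lemma plug_descend: "plug (Pair Atom Atom) (descend t bs fs) = plug (insert_key t bs) fs"
  by (induction bs arbitrary: t fs) auto

lemma length_descend: "length (descend t bs fs) = length bs + length fs"
  by (induction bs arbitrary: t fs) auto

section \<open>The loops going down and up\<close>

definition down_body :: com where
  "down_body = Seq
    (If (Hd (Var key_var))
      (Seq (Assign path_var (Cons (Cons (Hd (Var key_var)) (Hd (Var sub_var))) (Var path_var)))
        (Assign sub_var (Tl (Var sub_var))))
      (Seq (Assign path_var (Cons (Cons (Hd (Var key_var)) (Tl (Var sub_var))) (Var path_var)))
        (Assign sub_var (Hd (Var sub_var)))))
    (Assign key_var (Tl (Var key_var)))"

definition up_body :: com where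
  "up_body = Seq
    (If (Hd (Hd (Var path_var)))
      (Assign sub_var (Cons (Tl (Hd (Var path_var))) (Var sub_var)))
      (Assign sub_var (Cons (Var sub_var) (Tl (Hd (Var path_var))))))
    (Assign path_var (Tl (Var path_var)))"

text \<open>The key is its own loop counter and is used up. A round costs 17 for the body and 2 for
  the guard; the last, failing guard costs another 2.\<close>

lemma computes_down:
  "s key_var = encode_key bs \<Longrightarrow> s path_var = encode_frames fs \<Longrightarrow>
    computes (While (Var key_var) down_body) s (2 + 19 * length bs)
      (s(key_var := Atom, sub_var := subtrie (s sub_var) bs,
        path_var := encode_frames (descend (s sub_var) bs fs)))"
proof (induction bs arbitrary: s fs)
  case Nil
  have "s(key_var := Atom, sub_var := subtrie (s sub_var) [],
      path_var := encode_frames (descend (s sub_var) [] fs)) = s"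
    using Nil by auto
  moreover have "computes (While (Var key_var) down_body) s (2 + 19 * length []) s"
    by (rule computes_mono[OF computes_WhileFalse]) (use Nil in simp_all)
  ultimately show ?case by (simp only:)
next
  case (Cons b bs)
  let ?t = "s sub_var"
  define s1 where "s1 = s(key_var := encode_key bs, sub_var := child b ?t,
    path_var := encode_frames ((b, child (\<not> b) ?t) # fs))"
  have "effect down_body s = s1"
    using Cons.prems by (auto simp: s1_def down_body_def child_def fun_eq_iff)
  then have 1: "computes down_body s 17 s1"
    using computes_mono[OF computes_straight[of down_body s], of 17] by (simp add: down_body_def)
  have "computes (While (Var key_var) down_body) s1 (2 + 19 * length bs)
      (s1(key_var := Atom, sub_var := subtrie (s1 sub_var) bs,
        path_var := encode_frames (descend (s1 sub_var) bs ((b, child (\<not> b) ?t) # fs))))"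
    by (rule Cons.IH) (simp_all add: s1_def)
  moreover have "s1(key_var := Atom, sub_var := subtrie (s1 sub_var) bs,
        path_var := encode_frames (descend (s1 sub_var) bs ((b, child (\<not> b) ?t) # fs))) =
      s(key_var := Atom, sub_var := subtrie ?t (b # bs),
        path_var := encode_frames (descend ?t (b # bs) fs))"
    by (auto simp: s1_def)
  ultimately have 2: "computes (While (Var key_var) down_body) s1 (2 + 19 * length bs)
      (s(key_var := Atom, sub_var := subtrie ?t (b # bs),
        path_var := encode_frames (descend ?t (b # bs) fs)))"
    by (simp only:)
  show ?case
    by (rule computes_mono[OF computes_WhileTrue[OF _ 1 2]]) (use Cons.prems in simp_all)
qed

text \<open>Here the stack is the loop counter; a round costs 13 for the body and 2 for the
  guard.\<close>

lemma computes_up: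
  "s path_var = encode_frames fs \<Longrightarrow>
    computes (While (Var path_var) up_body) s (2 + 15 * length fs)
      (s(sub_var := plug (s sub_var) fs, path_var := Atom))"
proof (induction fs arbitrary: s)
  case Nil
  have "s(sub_var := plug (s sub_var) [], path_var := Atom) = s"
    using Nil by auto
  moreover have "computes (While (Var path_var) up_body) s (2 + 15 * length []) s"
    by (rule computes_mono[OF computes_WhileFalse]) (use Nil in simp_all)
  ultimately show ?case by (simp only:)
next
  case (Cons f fs)
  obtain b t where f: "f = (b, t)" by (cases f)
  define s1 where "s1 = s(sub_var := join b t (s sub_var), path_var := encode_frames fs)"
  have "effect up_body s = s1"
    using Cons.prems by (auto simp: s1_def up_body_def join_def f fun_eq_iff)
  then have 1: "computes up_body s 13 s1"
    using computes_mono[OF computes_straight[of up_body s], of 13] by (simp add: up_body_def)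
  have "computes (While (Var path_var) up_body) s1 (2 + 15 * length fs)
      (s1(sub_var := plug (s1 sub_var) fs, path_var := Atom))"
    by (rule Cons.IH) (simp_all add: s1_def)
  moreover have "s1(sub_var := plug (s1 sub_var) fs, path_var := Atom) =
      s(sub_var := plug (s sub_var) (f # fs), path_var := Atom)"
    by (auto simp: s1_def f)
  ultimately have 2: "computes (While (Var path_var) up_body) s1 (2 + 15 * length fs)
      (s(sub_var := plug (s sub_var) (f # fs), path_var := Atom))"
    by (simp only:)
  show ?case
    by (rule computes_mono[OF computes_WhileTrue[OF _ 1 2]]) (use Cons.prems f in simp_all)
qed

section \<open>The search\<close>

text \<open>After the descent \<open>sub_var\<close> holds the result of the lookup, which decides
  whether the key joins the worklist. The key is read again from \<open>found_var\<close>, since the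
  descent has consumed \<open>key_var\<close>. The mark is written in either case; for a key already
  present this changes no membership.\<close>

definition visit :: com where
  "visit = Seq
    (Seq
      (Seq
        (Seq (Assign key_var (Hd (Var found_var)))
          (Seq (Assign sub_var (Var trie_var)) (Assign path_var AtomE)))
        (While (Var key_var) down_body))
      (Seq
        (If (Var sub_var) Skip (Assign todo_var (Cons (Hd (Var found_var)) (Var todo_var))))
        (Assign sub_var (Cons AtomE AtomE))))
    (Seq
      (While (Var path_var) up_body)
      (Seq (Assign trie_var (Var sub_var)) (Assign found_var (Tl (Var found_var)))))"

text \<open>Going down costs 19 per bit and going up 15, which gives 34; the remaining 27 steps are
  rounded up to 40.\<close>

lemma computes_visit:
  assumes "s found_var = Pair (encode_key bs) v"
  shows "\<exists>s'. computes visit s (40 + 34 * length bs) s' \<and>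
    s' 0 = s 0 \<and> s' trie_var = insert_key (s trie_var) bs \<and> s' found_var = v \<and>
    s' todo_var = (if subtrie (s trie_var) bs = Atom then Pair (encode_key bs) (s todo_var)
      else s todo_var)"
proof -
  let ?init = "Seq (Assign key_var (Hd (Var found_var)))
    (Seq (Assign sub_var (Var trie_var)) (Assign path_var AtomE))"
  let ?push = "Seq
    (If (Var sub_var) Skip (Assign todo_var (Cons (Hd (Var found_var)) (Var todo_var))))
    (Assign sub_var (Cons AtomE AtomE))"
  let ?end = "Seq (Assign trie_var (Var sub_var)) (Assign found_var (Tl (Var found_var)))"
  define s1 where "s1 = effect ?init s"
  have 1: "computes ?init s 7 s1"
    unfolding s1_def using computes_mono[OF computes_straight[of ?init s], of 7] by simp
  have s1: "s1 key_var = encode_key bs" "s1 path_var = encode_frames []"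
      "s1 sub_var = s trie_var" "s1 0 = s 0" "s1 trie_var = s trie_var"
      "s1 found_var = s found_var" "s1 todo_var = s todo_var"
    using assms by (simp_all add: s1_def)
  define s2 where "s2 = s1(key_var := Atom, sub_var := subtrie (s1 sub_var) bs,
        path_var := encode_frames (descend (s1 sub_var) bs []))"
  have 2: "computes (While (Var key_var) down_body) s1 (2 + 19 * length bs) s2"
    unfolding s2_def by (rule computes_down) (use s1 in simp_all)
  define s3 where "s3 = effect ?push s2"
  have 3: "computes ?push s2 11 s3"
    unfolding s3_def using computes_mono[OF computes_straight[of ?push s2], of 11] by simp
  have s3: "s3 path_var = encode_frames (descend (s trie_var) bs [])" "s3 sub_var = Pair Atom Atom"
      "s3 0 = s 0" "s3 trie_var = s trie_var" "s3 found_var = s found_var"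
      "s3 todo_var = (if subtrie (s trie_var) bs = Atom then Pair (encode_key bs) (s todo_var)
        else s todo_var)"
    using s1 assms by (simp_all add: s3_def s2_def)
  define s4 where "s4 = s3(sub_var := plug (s3 sub_var) (descend (s trie_var) bs []),
    path_var := Atom)"
  have 4: "computes (While (Var path_var) up_body) s3 (2 + 15 * length bs) s4"
    unfolding s4_def using computes_up[of s3, OF s3(1)] by (simp add: length_descend)
  have 5: "computes ?end s4 5 (effect ?end s4)"
    using computes_mono[OF computes_straight[of ?end s4], of 5] by simp
  have "computes visit s (((7 + (2 + 19 * length bs)) + 11) + ((2 + 15 * length bs) + 5))
      (effect ?end s4)"
    unfolding visit_def
    by (intro computes_Seq[OF computes_Seq[OF computes_Seq[OF 1 2] 3]] computes_Seq[OF 4 5])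
  then have "computes visit s (40 + 34 * length bs) (effect ?end s4)"
    by (rule computes_mono) simp
  then show ?thesis
    using s3 assms by (intro exI[of _ "effect ?end s4"]) (simp add: s4_def plug_descend)
qed

section \<open>Inserting a list of keys\<close>

definition encode_keys :: "bool list list \<Rightarrow> sexp" where
  "encode_keys ks = encode_list (map encode_key ks)"

lemma encode_keys_simps [simp]:
  "encode_keys [] = Atom"
  "encode_keys (k # ks) = Pair (encode_key k) (encode_keys ks)"
  by (simp_all add: encode_keys_def encode_list_def)

definition visit_all :: com where
  "visit_all = While (Var found_var) visit"

text \<open>All keys of the worklist are in the trie, so a key absent from the trie can be pushed
  without creating a duplicate; a repeated entry of \<open>ks\<close> is found present the second
  time. The guard raises the 40 of \<open>visit\<close> to 42.\<close>

lemma computes_visit_all: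
  assumes "s found_var = encode_keys ks" "\<forall>k\<in>set ks. length k = n"
    "trie_of n V (s trie_var)" "s todo_var = encode_keys ws" "distinct ws" "set ws \<subseteq> V"
  shows "\<exists>s' ws'. computes visit_all s (2 + (42 + 34 * n) * length ks) s' \<and>
    s' 0 = s 0 \<and> s' found_var = Atom \<and> trie_of n (V \<union> set ks) (s' trie_var) \<and>
    s' todo_var = encode_keys ws' \<and> distinct ws' \<and> set ws' = set ws \<union> (set ks - V)"
  using assms
proof (induction ks arbitrary: s V ws)
  case Nil
  have "computes visit_all s (2 + (42 + 34 * n) * length []) s"
    unfolding visit_all_def by (rule computes_mono[OF computes_WhileFalse]) (use Nil in simp_all)
  then show ?case
    using Nil by (intro exI[of _ s] exI[of _ ws]) auto
next
  case (Cons k ks)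
  obtain s1 where 1: "computes visit s (40 + 34 * length k) s1"
    "s1 0 = s 0" "s1 trie_var = insert_key (s trie_var) k" "s1 found_var = encode_keys ks"
    "s1 todo_var = (if subtrie (s trie_var) k = Atom then Pair (encode_key k) (s todo_var)
      else s todo_var)"
    using computes_visit[of s k "encode_keys ks"] Cons.prems(1) by auto
  let ?ws = "if k \<in> V then ws else k # ws"
  have k: "length k = n" using Cons.prems by simp
  have "s1 todo_var = encode_keys ?ws"
    using 1(5) Cons.prems(3,4) k by (auto simp: trie_of_def)
  moreover have "trie_of n (insert k V) (s1 trie_var)"
    using trie_of_insert[OF Cons.prems(3) k] 1(3) by simp
  moreover have "distinct ?ws" "set ?ws \<subseteq> insert k V"
    using Cons.prems by auto
  ultimately obtain s' ws' where 2: "computes visit_all s1 (2 + (42 + 34 * n) * length ks) s'"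
    "s' 0 = s1 0" "s' found_var = Atom" "trie_of n (insert k V \<union> set ks) (s' trie_var)"
    "s' todo_var = encode_keys ws'" "distinct ws'" "set ws' = set ?ws \<union> (set ks - insert k V)"
    using Cons.IH[of s1 "insert k V" ?ws] Cons.prems(2) 1(4) by (meson list.set_intros(2))
  have "computes visit_all s (2 + (42 + 34 * n) * length (k # ks)) s'"
    unfolding visit_all_def
    by (rule computes_mono[OF computes_WhileTrue[OF _ 1(1) 2(1)[unfolded visit_all_def]]])
      (use Cons.prems(1) k in \<open>simp_all add: algebra_simps\<close>)
  moreover have "set ws' = set ws \<union> (set (k # ks) - V)"
    using 2(7) by auto
  ultimately show ?case
    using 1(2) 2 by (intro exI[of _ s'] exI[of _ ws']) auto
qed

text \<open>The key is popped only after the call, whose argument it is, and before the new keys are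
  pushed on top of the worklist.\<close>

definition process_next :: "com \<Rightarrow> com" where
  "process_next c = Seq (Output (Hd (Var todo_var)))
    (Seq (subroutine c (Cons (Var 0) (Hd (Var todo_var))))
      (Seq (Assign todo_var (Tl (Var todo_var))) visit_all))"

definition process_all :: "com \<Rightarrow> com" where
  "process_all c = While (Var todo_var) (process_next c)"

text \<open>The starting solution is treated like a neighbor: it arrives in
  \<open>found_var\<close>, and \<open>visit_all\<close> enters it into the trie and the worklist,
  both initially the atom and thus empty.\<close>

definition search :: "com \<Rightarrow> com \<Rightarrow> com" where
  "search c d = Seq (subroutine c (Var 0)) (Seq visit_all (process_all d))"

text \<open>The specification fixes only the set of outputs, whereas the time of
  \<open>visit_all\<close> depends on the list.\<close>

lemma obtain_keys:
  assumes "set vs = encode_key ` K"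
  obtains ks where "vs = map encode_key ks" "set ks = K"
proof -
  have "\<forall>v\<in>set vs. \<exists>k. v = encode_key k"
    using assms by auto
  then obtain ks where ks: "vs = map encode_key ks"
    using ex_map_conv[of vs encode_key] by auto
  then have "encode_key ` set ks = encode_key ` K"
    using assms by simp
  then have "set ks = K"
    using inj_encode_key inj_image_eq_iff by blast
  with ks that show thesis by blast
qed

lemma foldr_Pair_eq_encode_keys:
  "foldr Pair (rev (map encode_key ks)) Atom = encode_keys (rev ks)"
  by (simp add: encode_keys_def encode_list_def rev_map)

text \<open>The trace is split at its only output, since the ticks before and after it belong to
  different gaps. At most \<open>T\<close> neighbors are listed, each costing
  \<open>42 + 34 * n\<close>; the 11 is made up of 6 for the call, 3 for the pop and 2 for the last
  guard of \<open>visit_all\<close>.\<close>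

lemma exec_process_next:
  assumes "runs c (Pair (s 0) (encode_key w)) tr" "time tr \<le> T"
    "set (outputs tr) = encode_key ` K" "\<forall>k\<in>K. length k = n"
    "s todo_var = encode_keys (w # ws)" "distinct ws" "set ws \<subseteq> V"
    "trie_of n V (s trie_var)" "s found_var = Atom"
  shows "\<exists>a s' ws'. exec (process_next c) s
      (ticks (2 + nodes (encode_key w)) @ [Out (encode_key w)] @ ticks a) s' \<and>
    a \<le> 11 + 2 * com_bound c + 3 * T + (42 + 34 * n) * T \<and>
    s' 0 = s 0 \<and> s' found_var = Atom \<and> trie_of n (V \<union> K) (s' trie_var) \<and>
    s' todo_var = encode_keys ws' \<and> distinct ws' \<and> set ws' = set ws \<union> (K - V)"
proof -
  obtain ks where ks: "outputs tr = map encode_key ks" "set ks = K"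
    using obtain_keys[OF assms(3)] by blast
  have len: "length ks \<le> T"
  proof -
    have "length (outputs tr) \<le> time tr"
      using assms(1) length_outputs_le_time unfolding runs_def by blast
    then show ?thesis using ks assms(2) by simp
  qed
  let ?e = "Cons (Var 0) (Hd (Var todo_var))"
  have "eval ?e s = Pair (s 0) (encode_key w)"
    using assms(5) by simp
  from computes_subroutine[OF assms(1) _ this] obtain s1 where
    1: "computes (subroutine c ?e) s (2 + 2 * com_bound c + cost ?e + 3 * time tr) s1"
    and "\<forall>y<8. y \<noteq> found_var \<longrightarrow> s1 y = s y"
    and "s1 found_var = foldr Pair (rev (outputs tr)) (s found_var)"
    by auto
  then have s1: "s1 0 = s 0" "s1 trie_var = s trie_var" "s1 todo_var = encode_keys (w # ws)"
      "s1 found_var = encode_keys (rev ks)"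
    using ks(1) assms(5,9) by (simp_all add: foldr_Pair_eq_encode_keys)
  let ?pop = "Assign todo_var (Tl (Var todo_var))"
  define s2 where "s2 = s1(todo_var := encode_keys ws)"
  have 2: "computes ?pop s1 3 s2"
    using computes_Assign[of todo_var "Tl (Var todo_var)" s1] s1(3)
    by (simp add: s2_def numeral_3_eq_3)
  have "\<exists>s' ws'. computes visit_all s2 (2 + (42 + 34 * n) * length (rev ks)) s' \<and>
    s' 0 = s2 0 \<and> s' found_var = Atom \<and> trie_of n (V \<union> set (rev ks)) (s' trie_var) \<and>
    s' todo_var = encode_keys ws' \<and> distinct ws' \<and> set ws' = set ws \<union> (set (rev ks) - V)"
    by (rule computes_visit_all) (use s1 ks assms in \<open>simp_all add: s2_def\<close>)
  then obtain s' ws' where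
    3: "computes visit_all s2 (2 + (42 + 34 * n) * length ks) s'"
    and s': "s' 0 = s 0" "s' found_var = Atom" "trie_of n (V \<union> K) (s' trie_var)"
      "s' todo_var = encode_keys ws'" "distinct ws'" "set ws' = set ws \<union> (K - V)"
    using ks(2) s1(1) by (auto simp: s2_def)
  have "3 * time tr + (42 + 34 * n) * length ks \<le> 3 * T + (42 + 34 * n) * T"
    using assms(2) len by (intro add_mono mult_le_mono2)
  then have "computes (Seq (subroutine c ?e) (Seq ?pop visit_all)) s
      (11 + 2 * com_bound c + 3 * T + (42 + 34 * n) * T) s'"
    by (intro computes_mono[OF computes_Seq[OF 1 computes_Seq[OF 2 3]]]) simp
  then obtain a where a: "a \<le> 11 + 2 * com_bound c + 3 * T + (42 + 34 * n) * T"
    "exec (Seq (subroutine c ?e) (Seq ?pop visit_all)) s (ticks a) s'"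
    unfolding computes_def by blast
  have "exec (process_next c) s
      ((ticks (2 + nodes (encode_key w)) @ [Out (encode_key w)]) @ ticks a) s'"
    unfolding process_next_def
    by (rule exec.Seq[OF _ a(2)])
      (use exec.Output[of "Hd (Var todo_var)" s] assms(5) in \<open>simp add: numeral_2_eq_2\<close>)
  then show ?thesis
    using a(1) s' by (intro exI[of _ a] exI[of _ s'] exI[of _ ws']) simp
qed

text \<open>\<open>V\<close> is the set of seen keys and \<open>V - set ws\<close> that of keys
  already output, whose neighbors have all been seen. The induction is on the number of keys of
  \<open>X\<close> not yet output. The quantified \<open>g\<close> is the time elapsed since the
  previous output, as the first gap begins before this loop. The term \<open>5 + 4 * n\<close> pays
  for the guard (2), for evaluating the output expression (2) and for writing a key.\<close>

lemma exec_process_all: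
  fixes X :: "bool list set" and nb :: "bool list \<Rightarrow> bool list set"
  assumes "finite X" "\<forall>k\<in>X. length k = n" "\<forall>k\<in>X. nb k \<subseteq> X"
    and nb: "\<forall>k\<in>X. \<exists>tr. runs c (Pair v (encode_key k)) tr \<and> time tr \<le> T \<and>
      set (outputs tr) = encode_key ` nb k"
    and B: "11 + 2 * com_bound c + 3 * T + (42 + 34 * n) * T \<le> B"
    and "s 0 = v" "s found_var = Atom" "trie_of n V (s trie_var)" "s todo_var = encode_keys ws"
    "distinct ws" "set ws \<subseteq> V" "V \<subseteq> X" "\<forall>k\<in>V - set ws. nb k \<subseteq> V"
  shows "\<exists>tr s' ks. exec (process_all c) s tr s' \<and> outputs tr = map encode_key ks \<and> distinct ks \<and>
    set ks \<inter> (V - set ws) = {} \<and> V \<union> set ks \<subseteq> X \<and> V \<subseteq> (V - set ws) \<union> set ks \<and>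
    (\<forall>k\<in>(V - set ws) \<union> set ks. nb k \<subseteq> (V - set ws) \<union> set ks) \<and>
    (\<forall>g\<le>B. \<forall>x\<in>set (gaps g tr). x \<le> B + 5 + 4 * n)"
  using assms(6-)
proof (induction "card (X - (V - set ws))" arbitrary: s V ws rule: less_induct)
  case less
  show ?case
  proof (cases ws)
    case Nil
    then have "exec (process_all c) s (ticks 2) s"
      using exec.WhileFalse[of "Var todo_var" s "process_next c"] less.prems(4)
      by (simp add: process_all_def numeral_2_eq_2)
    moreover have "outputs (ticks 2) = map encode_key []"
      by simp
    moreover have "\<forall>g\<le>B. \<forall>x\<in>set (gaps g (ticks 2)). x \<le> B + 5 + 4 * n"
      by simp
    ultimately show ?thesis
      using less.prems(7,8) Nil
      by (intro exI[of _ "ticks 2"] exI[of _ s] exI[of _ "[]"]) auto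
  next
    case (Cons w us)
    have w: "w \<in> X" "w \<in> V" "w \<notin> set us" "distinct us" "set us \<subseteq> V"
      using less.prems Cons by auto
    obtain tr1 where "runs c (Pair (s 0) (encode_key w)) tr1" "time tr1 \<le> T"
      "set (outputs tr1) = encode_key ` nb w"
      using nb w(1) less.prems(1) by blast
    moreover have "\<forall>k\<in>nb w. length k = n"
      using assms(2,3) w(1) by blast
    ultimately have "\<exists>a s1 us'. exec (process_next c) s
        (ticks (2 + nodes (encode_key w)) @ [Out (encode_key w)] @ ticks a) s1 \<and>
      a \<le> 11 + 2 * com_bound c + 3 * T + (42 + 34 * n) * T \<and>
      s1 0 = s 0 \<and> s1 found_var = Atom \<and> trie_of n (V \<union> nb w) (s1 trie_var) \<and>
      s1 todo_var = encode_keys us' \<and> distinct us' \<and> set us' = set us \<union> (nb w - V)"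
      using w(4,5) less.prems(2,3,4) Cons by (intro exec_process_next) simp_all
    then obtain a s1 us' where
      1: "exec (process_next c) s
        (ticks (2 + nodes (encode_key w)) @ [Out (encode_key w)] @ ticks a) s1"
      and a: "a \<le> 11 + 2 * com_bound c + 3 * T + (42 + 34 * n) * T"
      and s1: "s1 0 = s 0" "s1 found_var = Atom" "trie_of n (V \<union> nb w) (s1 trie_var)"
        "s1 todo_var = encode_keys us'" "distinct us'" "set us' = set us \<union> (nb w - V)"
      by blast
    \<comment> \<open>Only \<open>w\<close> moves to the keys already output; its unseen neighbors
      join both the seen keys and the worklist.\<close>
    have done_eq: "(V \<union> nb w) - set us' = insert w (V - set ws)"
      using s1(6) w Cons by auto
    \<comment> \<open>The inclusion is strict because \<open>w\<close> was still in the
      worklist.\<close>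
    have "X - insert w (V - set ws) \<subset> X - (V - set ws)"
      using w Cons by auto
    then have smaller: "card (X - ((V \<union> nb w) - set us')) < card (X - (V - set ws))"
      unfolding done_eq using assms(1) by (intro psubset_card_mono) auto
    have VX: "V \<union> nb w \<subseteq> X"
      using assms(3) less.prems(7) w(1) by blast
    have closed: "\<forall>k\<in>(V \<union> nb w) - set us'. nb k \<subseteq> V \<union> nb w"
      unfolding done_eq using less.prems(8) by blast
    have us': "set us' \<subseteq> V \<union> nb w"
      using s1(6) w(5) by blast
    have "s1 0 = v"
      using s1(1) less.prems(1) by simp
    from less.hyps[OF smaller this s1(2,3,4,5) us' VX closed, unfolded done_eq]
    obtain tr s' ks where 2: "exec (process_all c) s1 tr s'" "outputs tr = map encode_key ks"
      "distinct ks" "set ks \<inter> insert w (V - set ws) = {}" "(V \<union> nb w) \<union> set ks \<subseteq> X"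
      "V \<union> nb w \<subseteq> insert w (V - set ws) \<union> set ks"
      "\<forall>k\<in>insert w (V - set ws) \<union> set ks. nb k \<subseteq> insert w (V - set ws) \<union> set ks"
      "\<forall>g\<le>B. \<forall>x\<in>set (gaps g tr). x \<le> B + 5 + 4 * n"
      by (elim exE conjE) (rule that)
    let ?tr = "ticks 2 @ (ticks (2 + nodes (encode_key w)) @ [Out (encode_key w)] @ ticks a) @ tr"
    have run: "exec (process_all c) s ?tr s'"
      using exec.WhileTrue[OF _ 1 2(1)[unfolded process_all_def]]
        less.prems(4) Cons
      by (simp add: process_all_def numeral_2_eq_2)
    have out: "outputs ?tr = map encode_key (w # ks)"
      using 2(2) by simp
    have gaps: "\<forall>g\<le>B. \<forall>x\<in>set (gaps g ?tr). x \<le> B + 5 + 4 * n"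
    proof (intro allI impI)
      fix g assume "g \<le> B"
      moreover have "a \<le> B" using a B by simp
      then have "\<forall>x\<in>set (gaps a tr). x \<le> B + 5 + 4 * n"
        using 2(8) by blast
      \<comment> \<open>The time \<open>a\<close> spent after the output is carried over into the
        first gap of the remaining run, which is why the induction hypothesis must allow any start
        up to \<open>B\<close>.\<close>
      moreover have "gaps g ?tr = (g + 2 + (2 + nodes (encode_key w))) # gaps a tr"
        by (simp only: gaps_ticks_append append_assoc append.simps gaps.simps add_0)
      ultimately show "\<forall>x\<in>set (gaps g ?tr). x \<le> B + 5 + 4 * n"
        using nodes_encode_key[of w] assms(2) w(1) by auto
    qed
    have eq: "(V - set ws) \<union> set (w # ks) = insert w (V - set ws) \<union> set ks"
      by auto
    have ks: "distinct (w # ks)" "set (w # ks) \<inter> (V - set ws) = {}" "V \<union> set (w # ks) \<subseteq> X"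
      "V \<subseteq> (V - set ws) \<union> set (w # ks)"
      using 2(3-6) w(1) Cons unfolding eq by auto
    have ks_closed: "\<forall>k\<in>(V - set ws) \<union> set (w # ks). nb k \<subseteq> (V - set ws) \<union> set (w # ks)"
      using 2(7) unfolding eq .
    show ?thesis
      by (rule exI[of _ ?tr], rule exI[of _ s'], rule exI[of _ "w # ks"])
        (intro conjI run out ks ks_closed gaps)
  qed
qed

text \<open>One \<open>B\<close> covers both the work after an output and the preparation before the
  loop. The latter takes \<open>3 + 2 * com_bound c + 3 * T1\<close> for the call and at most
  \<open>44 + 34 * n\<close> for visiting the at most one starting key, whence the 47.\<close>

lemma runs_search:
  fixes X :: "bool list set" and nb :: "bool list \<Rightarrow> bool list set"
  assumes "finite X" "\<forall>k\<in>X. length k = n" "\<forall>k\<in>X. nb k \<subseteq> X"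
    and nb: "\<forall>k\<in>X. \<exists>tr. runs d (Pair v (encode_key k)) tr \<and> time tr \<le> T \<and>
      set (outputs tr) = encode_key ` nb k"
    and start: "runs c v tr1" "time tr1 \<le> T1" "outputs tr1 = map encode_key ks1"
      "set ks1 \<subseteq> X" "length ks1 \<le> 1"
    and B: "11 + 2 * com_bound d + 3 * T + (42 + 34 * n) * T + 47 + 34 * n +
      2 * com_bound c + 3 * T1 \<le> B"
  shows "\<exists>tr ks. runs (search c d) v tr \<and> outputs tr = map encode_key ks \<and> distinct ks \<and>
    set ks1 \<subseteq> set ks \<and> set ks \<subseteq> X \<and> (\<forall>k\<in>set ks. nb k \<subseteq> set ks) \<and>
    (\<forall>x\<in>set (gaps 0 tr). x \<le> B + 5 + 4 * n)"
proof -
  let ?s = "(\<lambda>_. Atom)(0 := v)"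
  have "\<exists>s1. computes (subroutine c (Var 0)) ?s
      (2 + 2 * com_bound c + cost (Var 0) + 3 * time tr1) s1 \<and>
    (\<forall>y<8. y \<noteq> found_var \<longrightarrow> s1 y = ?s y) \<and>
    s1 found_var = foldr Pair (rev (outputs tr1)) (?s found_var)"
    by (rule computes_subroutine[OF start(1)]) auto
  then obtain s1 where
    1: "computes (subroutine c (Var 0)) ?s (2 + 2 * com_bound c + cost (Var 0) + 3 * time tr1) s1"
    and "\<forall>y<8. y \<noteq> found_var \<longrightarrow> s1 y = ?s y"
    and "s1 found_var = foldr Pair (rev (outputs tr1)) (?s found_var)"
    by blast
  then have s1: "s1 0 = v" "s1 trie_var = Atom" "s1 todo_var = encode_keys []"
      "s1 found_var = encode_keys (rev ks1)"
    using start(3) by (simp_all add: foldr_Pair_eq_encode_keys)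
  have "\<exists>s2 ws. computes visit_all s1 (2 + (42 + 34 * n) * length (rev ks1)) s2 \<and>
    s2 0 = s1 0 \<and> s2 found_var = Atom \<and> trie_of n ({} \<union> set (rev ks1)) (s2 trie_var) \<and>
    s2 todo_var = encode_keys ws \<and> distinct ws \<and> set ws = set [] \<union> (set (rev ks1) - {})"
    by (rule computes_visit_all) (use s1 start(4) assms(2) trie_of_empty in auto)
  then obtain s2 ws where
    2: "computes visit_all s1 (2 + (42 + 34 * n) * length ks1) s2"
    and s2: "s2 0 = v" "s2 found_var = Atom" "trie_of n (set ks1) (s2 trie_var)"
      "s2 todo_var = encode_keys ws" "distinct ws" "set ws = set ks1"
    using s1(1) by auto
  from 1 2 obtain a b where
    ab: "exec (subroutine c (Var 0)) ?s (ticks a) s1" "exec visit_all s1 (ticks b) s2"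
      "a \<le> 3 + 2 * com_bound c + 3 * time tr1" "b \<le> 2 + (42 + 34 * n) * length ks1"
    unfolding computes_def by auto
  have "(42 + 34 * n) * length ks1 \<le> (42 + 34 * n) * 1"
    using start(5) by (rule mult_le_mono2)
  then have "b \<le> 2 + (42 + 34 * n) * 1"
    by (intro order_trans[OF ab(4)] add_left_mono)
  then have "b \<le> 44 + 34 * n"
    by simp
  moreover have "47 + 34 * n + 2 * com_bound c + 3 * T1 \<le> B"
    using B by (rule order_trans[rotated]) simp
  ultimately have abB: "a + b \<le> B"
    using ab(3) start(2) by linarith
  \<comment> \<open>At the start the worklist holds all seen keys, so
    \<open>set ks1 - set ws\<close> is empty and the closure statement becomes one about
    \<open>ks\<close> alone.\<close>
  have "\<exists>tr s' ks. exec (process_all d) s2 tr s' \<and> outputs tr = map encode_key ks \<and> distinct ks \<and>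
    set ks \<inter> (set ks1 - set ws) = {} \<and> set ks1 \<union> set ks \<subseteq> X \<and>
    set ks1 \<subseteq> (set ks1 - set ws) \<union> set ks \<and>
    (\<forall>k\<in>(set ks1 - set ws) \<union> set ks. nb k \<subseteq> (set ks1 - set ws) \<union> set ks) \<and>
    (\<forall>g\<le>B. \<forall>x\<in>set (gaps g tr). x \<le> B + 5 + 4 * n)"
    by (rule exec_process_all[OF assms(1-3) nb _ s2(1-5)]) (use B s2(6) start(4) in simp_all)
  then obtain tr s' ks where
    3: "exec (process_all d) s2 tr s'" "outputs tr = map encode_key ks" "distinct ks"
      "set ks1 \<union> set ks \<subseteq> X" "set ks1 \<subseteq> set ks" "\<forall>k\<in>set ks. nb k \<subseteq> set ks"
      "\<forall>g\<le>B. \<forall>x\<in>set (gaps g tr). x \<le> B + 5 + 4 * n"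
    unfolding s2(6) Diff_cancel Un_empty_left by blast
  have "runs (search c d) v (ticks a @ ticks b @ tr)"
    unfolding runs_def search_def using exec.Seq[OF ab(1) exec.Seq[OF ab(2) 3(1)]] by blast
  moreover have "\<forall>x\<in>set (gaps 0 (ticks a @ ticks b @ tr)). x \<le> B + 5 + 4 * n"
    using 3(7) abB by simp
  ultimately show ?thesis
    using 3(2-6) by (intro exI[of _ "ticks a @ ticks b @ tr"] exI[of _ ks]) simp
qed

section \<open>Listing the solutions\<close>

lemma gaps_not_Nil: "gaps k tr \<noteq> []"
  by (induction k tr rule: gaps.induct) auto

lemma delay_le: "\<forall>x\<in>set (gaps 0 tr). x \<le> B \<Longrightarrow> delay tr \<le> B"
  unfolding delay_def using gaps_not_Nil by (intro Max.boundedI) auto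

section \<open>From keys back to solutions\<close>

definition key :: "('i, 'u) listing_problem \<Rightarrow> 'i \<Rightarrow> 'u set \<Rightarrow> bool list" where
  "key P i S = map (\<lambda>u. u \<in> S) (elements P i)"

lemma encode_set_eq: "encode_set P i S = encode_key (key P i S)"
  by (simp add: encode_set_def encode_key_def key_def comp_def)

lemma inj_on_key: "inj_on (key P i) (Pow (universe P i))"
  using inj_on_encode_set[of P i] unfolding inj_on_def encode_set_eq by metis

text \<open>If \<open>T\<close> were missing from \<open>R\<close>, take a member \<open>S\<close>
  of \<open>R\<close> of maximal proximity to \<open>T\<close>. As \<open>S\<close> differs from
  \<open>T\<close>, some neighbor of \<open>S\<close> is closer to \<open>T\<close>, and closure
  puts it in \<open>R\<close>, against maximality.\<close>

lemma closed_under_neighbors: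
  fixes prox :: "'u set \<Rightarrow> 'u set \<Rightarrow> 'u set"
  assumes "finite R" "R \<noteq> {}" "R \<subseteq> \<S>" "\<forall>S\<in>R. nb S \<subseteq> R"
    and closer: "\<forall>S\<in>\<S>. \<forall>T\<in>\<S>. S \<noteq> T \<longrightarrow> (\<exists>S'\<in>nb S. card (prox S' T) > card (prox S T))"
  shows "R = \<S>"
proof (rule ccontr)
  assume "R \<noteq> \<S>"
  then obtain T where T: "T \<in> \<S>" "T \<notin> R" using assms(3) by blast
  let ?f = "\<lambda>S. card (prox S T)"
  have "Max (?f ` R) \<in> ?f ` R" using assms(1,2) by simp
  then obtain S where S: "S \<in> R" "?f S = Max (?f ` R)" by auto
  then have "S \<in> \<S>" "S \<noteq> T" using T assms(3) by auto
  with closer T(1) have "\<exists>S'\<in>nb S. ?f S' > ?f S" by simp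
  then obtain S' where S': "S' \<in> nb S" "?f S' > ?f S" by (rule bexE)
  have "S' \<in> R" using assms(4) S(1) S'(1) by auto
  then have "?f S' \<le> Max (?f ` R)"
    using assms(1) by (intro Max_ge) auto
  then show False using S(2) S'(2) by simp
qed

theorem theorem3p2:
  fixes P :: "('i, 'u) listing_problem"
  assumes "listing_problem P"
    and "proximity_searchable P"
  shows "\<exists>c. poly_delay_listing_algorithm P c"
proof -
  obtain prox :: "'i \<Rightarrow> 'u set \<Rightarrow> 'u set \<Rightarrow> 'u set" and neighbors where
    nb_sub: "\<forall>i\<in>instances P. \<forall>S\<in>solutions P i. neighbors i S \<subseteq> solutions P i"
    and "solution_poly_time P" "neighbors_poly_time P neighbors"
    and closer: "\<forall>i\<in>instances P. \<forall>S\<in>solutions P i. \<forall>T\<in>solutions P i. S \<noteq> T \<longrightarrow>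
        (\<exists>S'\<in>neighbors i S. card (prox i S' T) > card (prox i S T))"
    using assms(2) unfolding proximity_searchable_def by auto
  then obtain c p d q where
    c: "\<forall>i\<in>instances P. \<exists>tr. runs c (input P i) tr \<and> time tr \<le> poly p (card (universe P i)) \<and>
      (if solutions P i = {} then outputs tr = []
       else \<exists>S\<in>solutions P i. outputs tr = [encode_set P i S])"
    and d: "\<forall>i\<in>instances P. \<forall>S\<in>solutions P i. \<exists>tr.
      runs d (Pair (input P i) (encode_set P i S)) tr \<and>
      time tr \<le> poly q (card (universe P i)) \<and>
      set (outputs tr) = encode_set P i ` neighbors i S"
    unfolding solution_poly_time_def neighbors_poly_time_def by auto
  \<comment> \<open>This evaluates to \<open>B + 5 + 4 * n\<close> for the \<open>B\<close> defined
    below and \<open>n\<close> the size of the universe: \<open>63 = 11 + 47 + 5\<close>,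
    \<open>38 = 34 + 4\<close>, and \<open>[:42, 34:] * q\<close> is the cost of visiting the
    neighbors.\<close>
  define r where "r = [:63 + 2 * com_bound d + 2 * com_bound c, 38:] + smult 3 p + smult 3 q +
    [:42, 34:] * q"
  have "\<exists>tr. runs (search c d) (input P i) tr \<and> distinct (outputs tr) \<and>
      set (outputs tr) = encode_set P i ` solutions P i \<and> delay tr \<le> poly r (card (universe P i))"
    if i: "i \<in> instances P" for i
  proof -
    let ?n = "card (universe P i)" and ?sols = "solutions P i" and ?key = "key P i"
    have dist: "distinct (elements P i)" and sols: "?sols \<subseteq> Pow (universe P i)"
      using assms(1) i unfolding listing_problem_def by auto
    have len: "length (?key S) = ?n" for S
      using distinct_card[OF dist] by (simp add: key_def universe_def)
    have fin: "finite ?sols"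
      using sols finite_subset by (auto simp: universe_def)
    have inj: "inj_on ?key ?sols"
      using inj_on_subset[OF inj_on_key sols] .
    \<comment> \<open>The neighboring function is transported to keys along the inverse of
      \<open>key\<close>, which is meaningful only on keys of solutions.\<close>
    define nb where "nb k = ?key ` neighbors i (the_inv_into ?sols ?key k)" for k
    have nb_key: "nb (?key S) = ?key ` neighbors i S" if "S \<in> ?sols" for S
      using the_inv_into_f_f[OF inj that] by (simp add: nb_def)
    obtain tr1 where tr1: "runs c (input P i) tr1" "time tr1 \<le> poly p ?n"
      "if ?sols = {} then outputs tr1 = [] else \<exists>S\<in>?sols. outputs tr1 = [encode_set P i S]"
      using c i by blast
    obtain ks1 where ks1: "outputs tr1 = map encode_key ks1" "set ks1 \<subseteq> ?key ` ?sols"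
      "length ks1 \<le> 1" "?sols \<noteq> {} \<longrightarrow> ks1 \<noteq> []"
    proof (cases "?sols = {}")
      case True
      then show thesis using tr1(3) that[of "[]"] by simp
    next
      case False
      then obtain S where "S \<in> ?sols" "outputs tr1 = [encode_set P i S]"
        using tr1(3) by auto
      then show thesis using that[of "[?key S]"] by (simp add: encode_set_eq)
    qed
    define B where "B = 11 + 2 * com_bound d + 3 * poly q ?n + (42 + 34 * ?n) * poly q ?n +
      47 + 34 * ?n + 2 * com_bound c + 3 * poly p ?n"
    have "\<exists>tr ks. runs (search c d) (input P i) tr \<and> outputs tr = map encode_key ks \<and>
      distinct ks \<and> set ks1 \<subseteq> set ks \<and> set ks \<subseteq> ?key ` ?sols \<and>
      (\<forall>k\<in>set ks. nb k \<subseteq> set ks) \<and> (\<forall>x\<in>set (gaps 0 tr). x \<le> B + 5 + 4 * ?n)"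
    proof (rule runs_search[OF _ _ _ _ tr1(1,2) ks1(1-3)])
      show "\<forall>k\<in>?key ` ?sols. nb k \<subseteq> ?key ` ?sols"
        using nb_sub i nb_key by auto
      show "\<forall>k\<in>?key ` ?sols. \<exists>tr. runs d (Pair (input P i) (encode_key k)) tr \<and>
          time tr \<le> poly q ?n \<and> set (outputs tr) = encode_key ` nb k"
        using d i nb_key by (simp add: encode_set_eq image_image)
    qed (use fin len in \<open>simp_all add: B_def\<close>)
    then obtain tr ks where tr: "runs (search c d) (input P i) tr"
      "outputs tr = map encode_key ks" "distinct ks" "set ks1 \<subseteq> set ks" "set ks \<subseteq> ?key ` ?sols"
      "\<forall>k\<in>set ks. nb k \<subseteq> set ks" "\<forall>x\<in>set (gaps 0 tr). x \<le> B + 5 + 4 * ?n"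
      by blast
    have "set ks = ?key ` ?sols"
    proof (cases "?sols = {}")
      \<comment> \<open>Without solutions there is no starting key, and the closure argument, which
        needs a nonempty set, does not apply.\<close>
      case True
      then show ?thesis using tr(5) by simp
    next
      case False
      \<comment> \<open>The listed keys are pulled back to solutions. The starting solution makes
        \<open>R\<close> nonempty, and closure of the keys under \<open>nb\<close> becomes closure
        of \<open>R\<close> under \<open>neighbors i\<close>.\<close>
      define R where "R = {S \<in> ?sols. ?key S \<in> set ks}"
      have first: "hd ks1 \<in> set ks" using ks1(4) tr(4) False hd_in_set by blast
      then obtain S where "hd ks1 = ?key S" "S \<in> ?sols" by (rule imageE[OF subsetD[OF tr(5)]])
      with first have "R \<noteq> {}" by (auto simp: R_def)
      moreover have "\<forall>S\<in>R. neighbors i S \<subseteq> R"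
      proof
        fix S assume "S \<in> R"
        then have S: "S \<in> ?sols" "?key S \<in> set ks" by (simp_all add: R_def)
        have "?key ` neighbors i S \<subseteq> set ks"
          using bspec[OF tr(6) S(2)] unfolding nb_key[OF S(1)] .
        moreover have "neighbors i S \<subseteq> ?sols" using nb_sub i S(1) by blast
        ultimately show "neighbors i S \<subseteq> R" unfolding R_def by blast
      qed
      moreover have "finite R" "R \<subseteq> ?sols" using fin by (simp_all add: R_def)
      ultimately have "R = ?sols"
        using closed_under_neighbors[OF _ _ _ _ bspec[OF closer i]] by blast
      then show ?thesis using tr(5) unfolding R_def by blast
    qed
    moreover have "distinct (outputs tr)"
      using tr(2,3) inj_on_subset[OF inj_encode_key subset_UNIV] by (simp add: distinct_map)
    moreover have "delay tr \<le> poly r ?n"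
      using delay_le[OF tr(7)] by (simp add: B_def r_def algebra_simps)
    ultimately show ?thesis
      using tr(1,2) by (intro exI[of _ tr]) (simp add: encode_set_eq image_image)
  qed
  then show ?thesis
    unfolding poly_delay_listing_algorithm_def
    by (intro exI[of _ "search c d"] exI[of _ r] ballI)
qed

end
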